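(* Let $C_0>0$ be a uniform constant such that for every increasing homeomorphism $h\colon\mathbb{R}\to\mathbb{R}$ and for all $x\in\mathbb{R}$, $y>0$, $$\frac{\rho_h(x,y)}{4}\leq K_h(x,y) \leq C_0 \max \left\{\rho_h(x,y), \frac{2}{y}\int_{-y/4}^{y/4} \rho_h(x+z,y-|z|)\, dz \right\}.$$ There exists a uniform (absolute) constant $C>0$ such that the following holds. Let $\Phi\colon [0,\infty)\to [0,\infty)$ be an increasing convex function and suppose that $h\colon \mathbb{R}\to \mathbb{R}$ is an increasing homeomorphism. Then for all $q>0$ we have $$\int_{\mathbb{H}} \Phi(q4^{-1}C_0^{-1}\rho_h) \, d\sigma\leq \int_{\mathbb{H}} \Phi(qC_0^{-1}K_h) \, d\sigma \leq C\int_{\mathbb{H}} \Phi(q \rho_h) \, d\sigma.$$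
   Context: $\mathbb{H}=\{(x,y)\in\mathbb{R}^2:y>0\}$ is the upper half-plane. $\sigma$ is the spherical measure, $d\sigma=\frac{4\,dx\,dy}{(1+x^2+y^2)^2}$. Integrals take values in $[0,\infty]$. For an increasing homeomorphism $h\colon\mathbb{R}\to\mathbb{R}$, $x\in\mathbb{R}$, $t>0$, the symmetric distortion function is $$\rho_h(x,t)= \max \left\{ \frac{|h(x+t)-h(x)|}{|h(x)-h(x-t)|}, \frac{|h(x)-h(x-t)|}{|h(x+t)-h(x)|}\right\}.$$ The Beurling--Ahlfors extension of $h$ is the map $H\colon\overline{\mathbb{H}}\to\overline{\mathbb{H}}$ (where $\overline{\mathbb H}=\mathbb H\cup\mathbb R$) with $H|_{\mathbb{R}}=h$ and $H(x,y)=u(x,y)+iv(x,y)$ for $x\in\mathbb{R}$, $y>0$, where $$u(x,y)=\frac{1}{2y}\int_{x-y}^{x+y} h(t)\,dt,\qquad v(x,y)=\frac{1}{2y}\left( \int_{x}^{x+y} h(t)\,dt - \int_{x-y}^{x} h(t)\,dt\right).$$ It is a homeomorphism of $\overline{\mathbb{H}}$ and a $C^1$-diffeomorphism of $\mathbb{H}$. $K_h$ denotes the quasiconformal dilatation of $H$ in $\mathbb{H}$: $K_h(x,y)=\inf\{K\ge1: \|DH(x,y)\|^2\le K J_H(x,y)\}$, where $\|DH\|$ is the operator norm of the differential matrix and $J_H$ is the Jacobian determinant. An absolute constant $C_0$ with the property required in the claim exists (one can take $C_0=50$). *)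

theory Defs
  imports "HOL-Analysis.Analysis"
begin

definition increasing_homeo :: "(real \<Rightarrow> real) \<Rightarrow> bool" where
  "increasing_homeo h \<longleftrightarrow> strict_mono h \<and> (\<exists>g. homeomorphism UNIV UNIV h g)"

definition upper_half_plane :: "(real^2) set" where
  "upper_half_plane = {p. p $ 2 > 0}"

definition spherical_measure :: "(real^2) measure" where
  "spherical_measure =
     density lborel (\<lambda>p. ennreal (4 / (1 + (p $ 1)\<^sup>2 + (p $ 2)\<^sup>2)\<^sup>2))"

definition sym_distortion :: "(real \<Rightarrow> real) \<Rightarrow> real \<Rightarrow> real \<Rightarrow> real" where
  "sym_distortion h x t =
     max (\<bar>h (x + t) - h x\<bar> / \<bar>h x - h (x - t)\<bar>) (\<bar>h x - h (x - t)\<bar> / \<bar>h (x + t) - h x\<bar>)"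

definition BA_u :: "(real \<Rightarrow> real) \<Rightarrow> real \<Rightarrow> real \<Rightarrow> real" where
  "BA_u h x y = 1 / (2 * y) * integral {x - y..x + y} h"

definition BA_v :: "(real \<Rightarrow> real) \<Rightarrow> real \<Rightarrow> real \<Rightarrow> real" where
  "BA_v h x y = 1 / (2 * y) * (integral {x..x + y} h - integral {x - y..x} h)"

text \<open>The Beurling--Ahlfors extension is meant on the closed upper half-plane only;
  its values at points with negative second coordinate are irrelevant.\<close>

definition BA_extension :: "(real \<Rightarrow> real) \<Rightarrow> real^2 \<Rightarrow> real^2" where
  "BA_extension h p =
     (if p $ 2 > 0 then vector [BA_u h (p $ 1) (p $ 2), BA_v h (p $ 1) (p $ 2)]
      else vector [h (p $ 1), 0])"

text \<open>The infimum is taken in the reals, so it is meaningful only where some admissible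
  \<open>K\<close> exists, e.g. where the Jacobian determinant is positive. This is the case for
  the Beurling--Ahlfors extension at every point of the open half-plane.\<close>

definition qc_dilatation :: "(real^2 \<Rightarrow> real^2) \<Rightarrow> real^2 \<Rightarrow> real" where
  "qc_dilatation H p =
     Inf {K. K \<ge> 1 \<and>
       (onorm (\<lambda>w. jacobian H (at p) *v w))\<^sup>2 \<le> K * det (jacobian H (at p))}"

definition BA_dilatation :: "(real \<Rightarrow> real) \<Rightarrow> real \<Rightarrow> real \<Rightarrow> real" where
  "BA_dilatation h x y = qc_dilatation (BA_extension h) (vector [x, y])"

end

theory Submission
  imports Defs "HOL-Probability.Probability_Measure"
begin

text \<open>
  Both inequalities reduce to the assumed pointwise bounds on the dilatation \<open>K\<close> by the
  symmetric distortion \<open>\<rho>\<close>. The lower bound \<open>\<rho> / 4 \<le> K\<close> and monotonicity of \<open>\<Phi>\<close> give the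
  first integral inequality at once.

  For the second one, \<open>K / C0\<close> is at most the larger of \<open>\<rho>\<close> and the average of \<open>\<rho>\<close> over the
  tent-shaped path \<open>z \<mapsto> (x + z, y - \<bar>z\<bar>)\<close>, \<open>\<bar>z\<bar> \<le> y / 4\<close>, so that
  \<open>\<Phi> (q K / C0) \<le> \<Phi> (q \<rho>) + \<Phi> (q average)\<close>, and Jensen's inequality moves \<open>\<Phi>\<close> inside the average.
  After the substitution \<open>z = s y\<close> the path runs over a fixed interval \<open>\<bar>s\<bar> \<le> 1/4\<close>, and for each
  fixed \<open>s\<close> the point on the path depends linearly on \<open>(x, y)\<close>, through the map
  \<open>T\<^sub>s (x, y) = (x + s y, (1 - \<bar>s\<bar>) y)\<close>. This is the point of the argument: by Tonelli it
  suffices to compare the spherical integral of \<open>G \<circ> T\<^sub>s\<close> with that of \<open>G\<close>, uniformly in \<open>s\<close>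
  (lemma \<open>nn_integral_spherical_shear\<close>). The map \<open>T\<^sub>s\<close> has determinant \<open>1 - \<bar>s\<bar> \<ge> 3/4\<close>, and it
  at most doubles \<open>1 + x\<^sup>2 + y\<^sup>2\<close>, hence it divides the spherical density by at most 4. So \<open>4 / (3/4) < 6\<close> is an admissible constant for one \<open>s\<close>, therefore also for the
  average over \<open>s\<close>, and \<open>C = 1 + 6\<close> works.
\<close>

section \<open>Linear change of variables for nonnegative integrals\<close>

text \<open>The change of variables formula for linear maps, as an identity of Borel measures: it covers
  integrands of infinite integral, which occur in the theorem.\<close>

lemma lborel_matrix_image:
  fixes M :: "real^'n::{finite,wellorder}^'n::_"
  assumes "det M \<noteq> 0"
  shows "lborel = density (distr lborel borel ((*v) M)) (\<lambda>_. ennreal \<bar>det M\<bar>)"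
proof (rule lborel_eqI)
  have lin: "linear ((*v) M)" by (rule matrix_vector_mul_linear)
  have meas [measurable]: "(*v) M \<in> borel_measurable borel"
    by (intro borel_measurable_continuous_onI linear_continuous_on lin[THEN linear_conv_bounded_linear[THEN iffD1]])
  \<comment> \<open>The inverse exhibits the preimage of a box as an image, to which the volume formula for
      linear images applies.\<close>
  obtain B where B: "M ** B = mat 1" "B ** M = mat 1"
    using assms invertible_det_nz[of M] by (auto simp: invertible_def)
  fix l u :: "real^'n::_"
  assume le: "\<And>b. b \<in> Basis \<Longrightarrow> l \<bullet> b \<le> u \<bullet> b"
  define S where "S = (*v) M -` box l u"
  have S_image: "S = (*v) B ` box l u"
  proof (intro set_eqI iffI)
    fix x assume "x \<in> S"
    moreover have "x = B *v (M *v x)" by (simp add: matrix_vector_mul_assoc B)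
    ultimately show "x \<in> (*v) B ` box l u" unfolding S_def by blast
  next
    fix x assume "x \<in> (*v) B ` box l u"
    then show "x \<in> S" by (auto simp: S_def matrix_vector_mul_assoc B)
  qed
  have S: "S \<in> lmeasurable"
    unfolding S_image by (intro measurable_linear_image matrix_vector_mul_linear) simp
  have SB: "S \<in> sets borel"
    using meas unfolding S_def by (metis measurable_sets_borel sets_borel borel_open open_box)
  have MS: "(*v) M ` S = box l u"
    unfolding S_image by (auto simp: image_image matrix_vector_mul_assoc B)
  have "\<bar>det M\<bar> * measure lebesgue S = measure lebesgue (box l u)"
    using measure_linear_image[OF lin S] MS by simp
  then have "ennreal \<bar>det M\<bar> * emeasure lborel S = ennreal (measure lborel (box l u))"
    using S SB by (subst emeasure_eq_measure2) 
     (auto simp: ennreal_mult'[symmetric] fmeasurable_def)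
  also have "\<dots> = ennreal (\<Prod>b\<in>Basis. (u - l) \<bullet> b)"
    using le by (simp add: measure_lborel_box_eq)
  finally show "emeasure (density (distr lborel borel ((*v) M)) (\<lambda>_. ennreal \<bar>det M\<bar>)) (box l u)
      = ennreal (\<Prod>b\<in>Basis. (u - l) \<bullet> b)"
    by (simp add: emeasure_density_const emeasure_distr S_def)
qed simp

lemma nn_integral_matrix_change:
  fixes M :: "real^'n::{finite,wellorder}^'n::_"
  assumes [measurable]: "f \<in> borel_measurable borel" and "det M \<noteq> 0"
  shows "(\<integral>\<^sup>+p. f p \<partial>lborel) = ennreal \<bar>det M\<bar> * (\<integral>\<^sup>+p. f (M *v p) \<partial>lborel)"
proof -
  have [measurable]: "(*v) M \<in> borel_measurable borel"
    by (intro borel_measurable_continuous_onI linear_continuous_on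
        linear_conv_bounded_linear[THEN iffD1] matrix_vector_mul_linear)
  show ?thesis
    by (subst lborel_matrix_image[OF assms(2)])
      (simp add: nn_integral_density nn_integral_distr nn_integral_cmult)
qed

section \<open>Jensen's inequality on an interval\<close>

text \<open>A convex function on the open half-line, where \<open>f\<close> takes its values, is continuous, so that
  \<open>\<Phi> \<circ> f\<close> is integrable over the compact interval. The left-hand average is a gauge integral,
  the right-hand one a Lebesgue integral with values in \<open>[0, \<infinity>]\<close>.\<close>

lemma jensen_nn_integral_interval:
  fixes \<Phi> f :: "real \<Rightarrow> real"
  assumes "a < b" and f: "continuous_on {a..b} f" "\<And>x. x \<in> {a..b} \<Longrightarrow> f x > 0"
    and \<Phi>: "convex_on {0<..} \<Phi>" "\<And>t. t > 0 \<Longrightarrow> \<Phi> t \<ge> 0"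
  shows "ennreal (\<Phi> (integral {a..b} f / (b - a)))
    \<le> ennreal (1 / (b - a)) * (\<integral>\<^sup>+x\<in>{a..b}. ennreal (\<Phi> (f x)) \<partial>lborel)"
proof -
  define U where "U = density lborel (\<lambda>x. ennreal (indicator {a..b} x / (b - a)))"
  have "emeasure U (space U) = (\<integral>\<^sup>+x. ennreal (1 / (b - a)) * indicator {a..b} x \<partial>lborel)"
    unfolding U_def by (auto simp: emeasure_density intro!: nn_integral_cong split: split_indicator)
  also have "\<dots> = 1"
    using \<open>a < b\<close> by (simp add: nn_integral_cmult_indicator ennreal_mult'[symmetric])
  finally interpret prob_space U by (rule prob_spaceI)
  have UI: "integrable U g" "integral\<^sup>L U g = integral {a..b} g / (b - a)"
    if g: "continuous_on {a..b} g" "g \<in> borel_measurable lborel" for g :: "real \<Rightarrow> real"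
  proof -
    note si = borel_integrable_atLeastAtMost'[OF g(1)]
    have eq: "(indicator {a..b} x / (b - a)) *\<^sub>R g x = (indicator {a..b} x *\<^sub>R g x) / (b - a)" for x
      by simp
    show "integrable U g"
      unfolding U_def using \<open>a < b\<close> si g(2)
      by (subst integrable_density) (auto simp: eq set_integrable_def)
    show "integral\<^sup>L U g = integral {a..b} g / (b - a)"
      unfolding U_def using \<open>a < b\<close> g(2) set_borel_integral_eq_integral(2)[OF si]
      by (subst integral_density) (auto simp: eq set_lebesgue_integral_def)
  qed
  \<comment> \<open>Outside the interval \<open>f\<close> may be nonpositive or nonmeasurable; the value 1 there keeps
      the random variable measurable and inside the domain of convexity.\<close>
  define F where "F = (\<lambda>x. if x \<in> {a..b} then f x else 1)"
  have "continuous_on {a..b} F"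
    using f(1) by (rule continuous_on_eq) (simp add: F_def)
  moreover have "F \<in> borel_measurable lborel"
    unfolding F_def measurable_lborel2 by (intro borel_measurable_continuous_on_if f(1)) auto
  ultimately have F: "continuous_on {a..b} F" "F \<in> borel_measurable lborel" .
  have F_pos: "F x > 0" for x using f(2) by (simp add: F_def)
  have cont: "continuous_on {0<..} \<Phi>" using \<Phi>(1) by (intro convex_on_continuous) auto
  have PF: "continuous_on {a..b} (\<lambda>x. \<Phi> (F x))"
    by (rule continuous_on_compose2[OF cont F(1)]) (use F_pos in auto)
  have "(\<lambda>x. \<Phi> (F x)) = (\<lambda>x. if x \<in> {a..b} then \<Phi> (F x) else \<Phi> 1)"
    by (auto simp: F_def)
  also have "\<dots> \<in> borel_measurable borel"
    by (intro borel_measurable_continuous_on_if PF) auto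
  finally have PF_meas: "(\<lambda>x. \<Phi> (F x)) \<in> borel_measurable lborel" by simp
  have "integral {a..b} F = integral {a..b} f"
    by (rule Henstock_Kurzweil_Integration.integral_cong) (simp add: F_def)
  then have "\<Phi> (integral {a..b} f / (b - a)) = \<Phi> (expectation F)"
    using UI(2)[OF F] by simp
  also have "\<dots> \<le> expectation (\<lambda>x. \<Phi> (F x))"
    by (rule jensens_inequality[where I="{0<..}"]) (use UI(1)[OF F] UI(1)[OF PF PF_meas] F_pos \<Phi>(1) in auto)
  finally have "ennreal (\<Phi> (integral {a..b} f / (b - a))) \<le> ennreal (expectation (\<lambda>x. \<Phi> (F x)))"
    by (rule ennreal_leI)
  also have "\<dots> = (\<integral>\<^sup>+x. ennreal (\<Phi> (F x)) \<partial>U)"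
    using F_pos \<Phi>(2) UI(1)[OF PF PF_meas] by (intro nn_integral_eq_integral[symmetric]) auto
  also have "\<dots> = (\<integral>\<^sup>+x. ennreal (1 / (b - a)) * (ennreal (\<Phi> (F x)) * indicator {a..b} x) \<partial>lborel)"
    unfolding U_def using PF_meas
    by (subst nn_integral_density) (auto intro!: nn_integral_cong split: split_indicator)
  also have "\<dots> = ennreal (1 / (b - a)) * (\<integral>\<^sup>+x\<in>{a..b}. ennreal (\<Phi> (F x)) \<partial>lborel)"
    using PF_meas by (intro nn_integral_cmult) auto
  also have "(\<integral>\<^sup>+x\<in>{a..b}. ennreal (\<Phi> (F x)) \<partial>lborel) = (\<integral>\<^sup>+x\<in>{a..b}. ennreal (\<Phi> (f x)) \<partial>lborel)"
    by (intro nn_integral_cong) (auto simp: F_def split: split_indicator)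
  finally show ?thesis .
qed

section \<open>The shears and the spherical density\<close>

text \<open>The map \<open>T\<^sub>s\<close>, which sends \<open>(x, y)\<close> to the point with parameter \<open>z = s y\<close> on the tent-shaped
  path through \<open>(x, y)\<close>.\<close>

definition shear_matrix :: "real \<Rightarrow> real^2^2" where
  "shear_matrix s = vector [vector [1, s], vector [0, 1 - \<bar>s\<bar>]]"

lemma shear_matrix_apply:
  "shear_matrix s *v p = vector [p $ 1 + s * p $ 2, (1 - \<bar>s\<bar>) * p $ 2]"
  by (simp add: shear_matrix_def matrix_vector_mult_def vec_eq_iff forall_2 sum_2)

lemma det_shear_matrix: "det (shear_matrix s) = 1 - \<bar>s\<bar>"
  by (simp add: shear_matrix_def det_2)

text \<open>Joint measurability in \<open>(s, p)\<close> is what Tonelli's theorem requires.\<close>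

lemma measurable_shear:
  "(\<lambda>(s, p). shear_matrix s *v p) \<in> borel_measurable (borel \<Otimes>\<^sub>M borel)"
proof -
  have eq: "(\<lambda>(s, p). shear_matrix s *v p)
      = (\<lambda>x. \<chi> i. if i = 1 then snd x $ 1 + fst x * snd x $ 2 else (1 - \<bar>fst x\<bar>) * snd x $ 2)"
    by (auto simp: shear_matrix_apply vec_eq_iff forall_2)
  have "continuous_on UNIV (\<lambda>(s, p). shear_matrix s *v p)"
    unfolding eq
    apply (rule continuous_on_vec_lambda)
    subgoal for i by (cases "i = 1") (auto intro!: continuous_intros)
    done
  then show ?thesis
    unfolding borel_prod by (rule borel_measurable_continuous_onI)
qed

definition spherical_density :: "real^2 \<Rightarrow> real" where
  "spherical_density p = 4 / (1 + (p $ 1)\<^sup>2 + (p $ 2)\<^sup>2)\<^sup>2"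

lemma measurable_spherical_density [measurable]: "spherical_density \<in> borel_measurable borel"
  unfolding spherical_density_def
  apply (intro borel_measurable_continuous_onI continuous_intros)
  by (smt (verit) zero_le_power2 zero_eq_power2 one_add_one)

text \<open>From \<open>(x + s y)\<^sup>2 \<le> 2 x\<^sup>2 + 2 s\<^sup>2 y\<^sup>2\<close> and \<open>\<bar>s\<bar> \<le> 1/4\<close> the shear at most doubles
  \<open>1 + x\<^sup>2 + y\<^sup>2\<close>; the density is inversely proportional to the square of this quantity.\<close>

lemma spherical_density_shear:
  assumes s: "\<bar>s\<bar> \<le> 1 / 4"
  shows "spherical_density p \<le> 4 * spherical_density (shear_matrix s *v p)"
proof -
  define x y where "x = p $ 1" and "y = p $ 2"
  have "(x + s * y)\<^sup>2 + ((1 - \<bar>s\<bar>) * y)\<^sup>2 \<le> 2 * (x\<^sup>2 + y\<^sup>2)"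
  proof -
    have "(x + s * y)\<^sup>2 \<le> 2 * x\<^sup>2 + 2 * (s * y)\<^sup>2"
      using zero_le_power2[of "x - s * y"] unfolding power2_sum power2_diff by linarith
    also have "(s * y)\<^sup>2 \<le> (1 / 4 * y)\<^sup>2"
      using mult_right_mono[OF s abs_ge_zero[of y]]
      by (simp add: abs_mult flip: abs_le_square_iff)
    also have "(1 / 4 * y)\<^sup>2 = y\<^sup>2 / 16" by (simp add: power_divide)
    finally have "(x + s * y)\<^sup>2 \<le> 2 * x\<^sup>2 + 2 * (y\<^sup>2 / 16)" by simp
    then have "(x + s * y)\<^sup>2 \<le> 2 * x\<^sup>2 + y\<^sup>2"
      by (rule order_trans) simp
    moreover have "((1 - \<bar>s\<bar>) * y)\<^sup>2 \<le> y\<^sup>2"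
      using s by (auto simp: abs_mult mult_left_le_one_le simp flip: abs_le_square_iff)
    ultimately have "(x + s * y)\<^sup>2 + ((1 - \<bar>s\<bar>) * y)\<^sup>2 \<le> (2 * x\<^sup>2 + y\<^sup>2) + y\<^sup>2"
      by (rule add_mono)
    then show ?thesis by simp
  qed
  then have le: "1 + (x + s * y)\<^sup>2 + ((1 - \<bar>s\<bar>) * y)\<^sup>2 \<le> 2 * (1 + x\<^sup>2 + y\<^sup>2)" by simp
  have pos: "0 < 1 + (x + s * y)\<^sup>2 + ((1 - \<bar>s\<bar>) * y)\<^sup>2" "0 < 1 + x\<^sup>2 + y\<^sup>2"
    by (intro add_pos_nonneg zero_le_power2 zero_less_one)+
  have "(1 + (x + s * y)\<^sup>2 + ((1 - \<bar>s\<bar>) * y)\<^sup>2)\<^sup>2 \<le> (2 * (1 + x\<^sup>2 + y\<^sup>2))\<^sup>2"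
    using le pos(1) by (intro power_mono) auto
  also have "\<dots> = 4 * (1 + x\<^sup>2 + y\<^sup>2)\<^sup>2" by (subst power_mult_distrib) simp
  finally have "16 / (4 * (1 + x\<^sup>2 + y\<^sup>2)\<^sup>2) \<le> 16 / (1 + (x + s * y)\<^sup>2 + ((1 - \<bar>s\<bar>) * y)\<^sup>2)\<^sup>2"
    using pos by (intro divide_left_mono mult_pos_pos) auto
  then show ?thesis
    by (simp add: spherical_density_def shear_matrix_apply flip: x_def y_def)
qed

text \<open>First move the density along the shear at the cost of a factor 4, then change variables,
  which costs another \<open>1 / (1 - \<bar>s\<bar>) \<le> 4/3\<close>. The constant 6 is \<open>16/3\<close> rounded up.\<close>

lemma nn_integral_spherical_shear:
  fixes G :: "real^2 \<Rightarrow> ennreal"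
  assumes [measurable]: "G \<in> borel_measurable borel" and s: "\<bar>s\<bar> \<le> 1 / 4"
  shows "(\<integral>\<^sup>+p. spherical_density p * G (shear_matrix s *v p) \<partial>lborel)
    \<le> 6 * (\<integral>\<^sup>+p. spherical_density p * G p \<partial>lborel)"
proof -
  have [measurable]: "(*v) (shear_matrix s) \<in> borel_measurable borel"
    by (intro borel_measurable_continuous_onI linear_continuous_on
        linear_conv_bounded_linear[THEN iffD1] matrix_vector_mul_linear)
  define Y where "Y = (\<integral>\<^sup>+p. spherical_density (shear_matrix s *v p) * G (shear_matrix s *v p) \<partial>lborel)"
  have "(\<integral>\<^sup>+p. spherical_density p * G (shear_matrix s *v p) \<partial>lborel)
      \<le> (\<integral>\<^sup>+p. ennreal 4 * (spherical_density (shear_matrix s *v p) * G (shear_matrix s *v p)) \<partial>lborel)"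
  proof (rule nn_integral_mono)
    fix p
    have "ennreal (spherical_density p) \<le> ennreal 4 * ennreal (spherical_density (shear_matrix s *v p))"
      using spherical_density_shear[OF s, of p] by (metis ennreal_leI ennreal_mult' zero_le_numeral)
    then show "spherical_density p * G (shear_matrix s *v p)
        \<le> ennreal 4 * (spherical_density (shear_matrix s *v p) * G (shear_matrix s *v p))"
      by (metis mult.assoc mult_right_mono zero_le)
  qed
  also have "\<dots> = ennreal 4 * Y" unfolding Y_def by (intro nn_integral_cmult) measurable
  also have "\<dots> \<le> ennreal (6 * (1 - \<bar>s\<bar>)) * Y"
    using s by (intro mult_right_mono ennreal_leI) auto
  also have "ennreal (6 * (1 - \<bar>s\<bar>)) = 6 * ennreal \<bar>det (shear_matrix s)\<bar>"
    using s by (subst ennreal_mult') (auto simp: det_shear_matrix)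
  also have "6 * ennreal \<bar>det (shear_matrix s)\<bar> * Y = 6 * (ennreal \<bar>det (shear_matrix s)\<bar> * Y)"
    by (rule mult.assoc)
  also have "ennreal \<bar>det (shear_matrix s)\<bar> * Y = (\<integral>\<^sup>+p. spherical_density p * G p \<partial>lborel)"
    unfolding Y_def using s
    by (intro nn_integral_matrix_change[symmetric]) (auto simp: det_shear_matrix)
  finally show ?thesis .
qed

text \<open>The factor 2 normalises the integral over an interval of length \<open>1/2\<close>, so averaging over \<open>s\<close>
  does not worsen the constant.\<close>

lemma nn_integral_spherical_shear_average:
  fixes G :: "real^2 \<Rightarrow> ennreal"
  assumes [measurable]: "G \<in> borel_measurable borel"
  shows "(\<integral>\<^sup>+p. spherical_density p *
      (2 * (\<integral>\<^sup>+s\<in>{-1/4..1/4}. G (shear_matrix s *v p) \<partial>lborel)) \<partial>lborel)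
    \<le> 6 * (\<integral>\<^sup>+p. spherical_density p * G p \<partial>lborel)"
proof -
  have GT [measurable]: "(\<lambda>(s, p). G (shear_matrix s *v p)) \<in> borel_measurable (borel \<Otimes>\<^sub>M borel)"
    using measurable_compose[OF measurable_shear assms] by (simp add: case_prod_unfold)
  let ?I = "\<integral>\<^sup>+p. spherical_density p * G p \<partial>lborel"
  have "(\<integral>\<^sup>+p. spherical_density p *
      (2 * (\<integral>\<^sup>+s\<in>{-1/4..1/4}. G (shear_matrix s *v p) \<partial>lborel)) \<partial>lborel)
    = (\<integral>\<^sup>+p. (\<integral>\<^sup>+s. 2 * indicator {-1/4..1/4} s *
          (spherical_density p * G (shear_matrix s *v p)) \<partial>lborel) \<partial>lborel)"
    by (intro nn_integral_cong) (simp add: nn_integral_cmult[symmetric] mult_ac)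
  also have "\<dots> = (\<integral>\<^sup>+s. (\<integral>\<^sup>+p. 2 * indicator {-1/4..1/4} s *
          (spherical_density p * G (shear_matrix s *v p)) \<partial>lborel) \<partial>lborel)"
    by (rule lborel_pair.Fubini') measurable
  also have "\<dots> = (\<integral>\<^sup>+s. 2 * indicator {-1/4..1/4} s *
          (\<integral>\<^sup>+p. spherical_density p * G (shear_matrix s *v p) \<partial>lborel) \<partial>lborel)"
    by (intro nn_integral_cong nn_integral_cmult) measurable
  also have "\<dots> \<le> (\<integral>\<^sup>+s. (2 * (6 * ?I)) * indicator {-1/4..1/4::real} s \<partial>lborel)"
  proof (rule nn_integral_mono)
    fix s :: real
    show "2 * indicator {-1/4..1/4} s * (\<integral>\<^sup>+p. spherical_density p * G (shear_matrix s *v p) \<partial>lborel)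
        \<le> (2 * (6 * ?I)) * indicator {-1/4..1/4} s"
    proof (cases "s \<in> {-1/4..1/4}")
      case True
      then have "\<bar>s\<bar> \<le> 1 / 4" by (auto simp: abs_if)
      from nn_integral_spherical_shear[OF assms this] True show ?thesis
        by (simp only: indicator_simps mult_1_right mult_left_mono zero_le)
    qed simp
  qed
  also have "\<dots> = (2 * (6 * ?I)) * ennreal (1 / 2)"
    by (subst nn_integral_cmult_indicator) auto
  also have "\<dots> = (2 * ennreal (1 / 2)) * (6 * ?I)" by (simp only: mult_ac)
  also have "2 * ennreal (1 / 2) = 1"
    using ennreal_mult'[of 2 "1/2"] by simp
  finally show ?thesis by simp
qed


section \<open>The symmetric distortion function\<close>

lemma increasing_homeoD:
  assumes "increasing_homeo h"
  shows "continuous_on UNIV h" "a < b \<Longrightarrow> h a < h b"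
  using assms by (auto simp: increasing_homeo_def homeomorphism_def strict_mono_def)

text \<open>Of a positive number and its reciprocal, one is at least 1. This keeps the averages of the
  distortion in the open half-line, where convex functions are continuous.\<close>

lemma sym_distortion_ge_1:
  assumes "increasing_homeo h" "t > 0"
  shows "sym_distortion h x t \<ge> 1"
proof -
  define A B where "A = \<bar>h (x + t) - h x\<bar>" and "B = \<bar>h x - h (x - t)\<bar>"
  have "A > 0" "B > 0"
    using assms(2) increasing_homeoD(2)[OF assms(1), of x "x + t"]
      increasing_homeoD(2)[OF assms(1), of "x - t" x] by (auto simp: A_def B_def)
  then have "max (A / B) (B / A) \<ge> 1" by (cases "A \<le> B") (auto simp: le_max_iff_disj)
  then show ?thesis by (simp add: sym_distortion_def A_def B_def)
qed

lemma continuous_on_sym_distortion: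
  assumes h: "increasing_homeo h"
  shows "continuous_on upper_half_plane (\<lambda>p. sym_distortion h (p $ 1) (p $ 2))"
proof -
  note c = continuous_on_compose2[OF increasing_homeoD(1)[OF h]]
  have "h (p $ 1) \<noteq> h (p $ 1 - p $ 2)" "h (p $ 1 + p $ 2) \<noteq> h (p $ 1)"
    if "p \<in> upper_half_plane" for p
    using that increasing_homeoD(2)[OF h, of "p $ 1" "p $ 1 + p $ 2"]
      increasing_homeoD(2)[OF h, of "p $ 1 - p $ 2" "p $ 1"] by (auto simp: upper_half_plane_def)
  then show ?thesis
    unfolding sym_distortion_def by (intro continuous_intros c) auto
qed

lemma open_upper_half_plane: "open upper_half_plane"
  unfolding upper_half_plane_def by (intro open_Collect_less continuous_intros)

lemma sets_upper_half_plane [measurable]: "upper_half_plane \<in> sets borel"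
  using open_upper_half_plane by auto

lemma shear_in_upper_half_plane:
  assumes "p \<in> upper_half_plane" "\<bar>s\<bar> < 1"
  shows "shear_matrix s *v p \<in> upper_half_plane"
  using assms by (simp add: upper_half_plane_def shear_matrix_apply)

lemma nn_integral_spherical_measure:
  fixes G :: "real^2 \<Rightarrow> ennreal"
  assumes "G \<in> borel_measurable borel"
  shows "(\<integral>\<^sup>+p. G p \<partial>spherical_measure) = (\<integral>\<^sup>+p. spherical_density p * G p \<partial>lborel)"
  unfolding spherical_measure_def spherical_density_def[symmetric]
  using assms by (intro nn_integral_density) auto

section \<open>Averages over tent-shaped paths\<close>

text \<open>The substitution \<open>z = s y\<close>. It replaces an interval that depends on the point by a fixed one,
  as Tonelli's theorem needs in the sequel.\<close>

lemma tent_average_eq: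
  assumes y: "p $ 2 > 0"
    and R: "continuous_on upper_half_plane (\<lambda>p. f (p $ 1) (p $ 2))"
  shows "2 / p $ 2 * integral {- p $ 2 / 4..p $ 2 / 4} (\<lambda>z. f (p $ 1 + z) (p $ 2 - \<bar>z\<bar>)) =
    integral {-1/4..1/4} (\<lambda>s. f ((shear_matrix s *v p) $ 1) ((shear_matrix s *v p) $ 2))
      / (1/4 - (-1/4) :: real)"
proof -
  define x y where "x = p $ 1" and "y = p $ 2"
  have "y > 0" using y by (simp add: y_def)
  have "continuous_on {- y / 4..y / 4} (\<lambda>z. f ((vector [x + z, y - \<bar>z\<bar>] :: real^2) $ 1)
      ((vector [x + z, y - \<bar>z\<bar>] :: real^2) $ 2))"
  proof (rule continuous_on_compose2[OF R])
    have eq: "(\<lambda>z. vector [x + z, y - \<bar>z\<bar>] :: real^2) = (\<lambda>z. \<chi> i. if i = 1 then x + z else y - \<bar>z\<bar>)"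
      by (auto simp: vec_eq_iff forall_2)
    have "continuous_on {- y / 4..y / 4} (\<lambda>z. if i = 1 then x + z else y - \<bar>z\<bar>)" for i :: 2
      by (cases "i = 1") (auto intro!: continuous_intros)
    then show "continuous_on {- y / 4..y / 4} (\<lambda>z. vector [x + z, y - \<bar>z\<bar>] :: real^2)"
      unfolding eq by (rule continuous_on_vec_lambda)
  qed (use \<open>y > 0\<close> in \<open>auto simp: upper_half_plane_def\<close>)
  then have "(\<lambda>z. f (x + z) (y - \<bar>z\<bar>)) integrable_on {- y / 4..y / 4}"
    by (intro integrable_continuous_real) simp
  then have "((\<lambda>z. f (x + z) (y - \<bar>z\<bar>)) has_integral
      integral {- y / 4..y / 4} (\<lambda>z. f (x + z) (y - \<bar>z\<bar>))) (cbox (- y / 4) (y / 4))"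
    by (simp add: integrable_integral)
  from has_integral_affinity'[OF this \<open>y > 0\<close>, of 0]
  have "((\<lambda>s. f (x + y * s) (y - \<bar>y * s\<bar>)) has_integral
      integral {- y / 4..y / 4} (\<lambda>z. f (x + z) (y - \<bar>z\<bar>)) / y) {-1/4..1/4}"
    using \<open>y > 0\<close> by (simp add: field_simps)
  moreover have "f (x + y * s) (y - \<bar>y * s\<bar>)
      = f ((shear_matrix s *v p) $ 1) ((shear_matrix s *v p) $ 2)" for s
    using \<open>y > 0\<close> by (simp add: shear_matrix_apply x_def y_def abs_mult algebra_simps)
  ultimately have "integral {-1/4..1/4} (\<lambda>s. f ((shear_matrix s *v p) $ 1) ((shear_matrix s *v p) $ 2))
      = integral {- y / 4..y / 4} (\<lambda>z. f (x + z) (y - \<bar>z\<bar>)) / y"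
    by (simp add: integral_unique)
  then show ?thesis by (simp add: x_def y_def)
qed

lemma jensen_tent_average:
  assumes h: "increasing_homeo h" and p: "p \<in> upper_half_plane" and "q > 0"
    and \<Phi>: "convex_on {0<..} \<Phi>" "\<And>t. t > 0 \<Longrightarrow> \<Phi> t \<ge> 0"
  shows "ennreal (\<Phi> (q * (2 / p $ 2 *
      integral {- p $ 2 / 4..p $ 2 / 4} (\<lambda>z. sym_distortion h (p $ 1 + z) (p $ 2 - \<bar>z\<bar>)))))
    \<le> 2 * (\<integral>\<^sup>+s\<in>{-1/4..1/4}. ennreal (\<Phi> (q * sym_distortion h
        ((shear_matrix s *v p) $ 1) ((shear_matrix s *v p) $ 2))) \<partial>lborel)"
proof -
  let ?f = "\<lambda>s. sym_distortion h ((shear_matrix s *v p) $ 1) ((shear_matrix s *v p) $ 2)"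
  have T: "shear_matrix s *v p \<in> upper_half_plane" if "s \<in> {-1/4..1/4}" for s
    using that p by (intro shear_in_upper_half_plane) auto
  have eq: "(\<lambda>s. shear_matrix s *v p) = (\<lambda>s. \<chi> i. if i = 1 then p $ 1 + s * p $ 2 else (1 - \<bar>s\<bar>) * p $ 2)"
    by (auto simp: shear_matrix_apply vec_eq_iff forall_2)
  have "continuous_on {-1/4..1/4} (\<lambda>s. if i = 1 then p $ 1 + s * p $ 2 else (1 - \<bar>s\<bar>) * p $ 2)" for i :: 2
    by (cases "i = 1") (auto intro!: continuous_intros)
  then have "continuous_on {-1/4..1/4} (\<lambda>s. shear_matrix s *v p)"
    unfolding eq by (rule continuous_on_vec_lambda)
  then have f: "continuous_on {-1/4..1/4} ?f"
    by (rule continuous_on_compose2[OF continuous_on_sym_distortion[OF h]]) (use T in auto)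
  have pos: "?f s > 0" if "s \<in> {-1/4..1/4}" for s
    using sym_distortion_ge_1[OF h, of "(shear_matrix s *v p) $ 2" "(shear_matrix s *v p) $ 1"] T[OF that]
    by (simp add: upper_half_plane_def)
  have "ennreal (\<Phi> (integral {-1/4..1/4} (\<lambda>s. q * ?f s) / (1/4 - (-1/4))))
      \<le> ennreal (1 / (1/4 - (-1/4))) * (\<integral>\<^sup>+s\<in>{-1/4..1/4}. ennreal (\<Phi> (q * ?f s)) \<partial>lborel)"
    using \<open>q > 0\<close> pos \<Phi> f by (intro jensen_nn_integral_interval) (auto intro!: continuous_intros)
  moreover have "integral {-1/4..1/4} (\<lambda>s. q * ?f s) / (1/4 - (-1/4)) =
      q * (2 / p $ 2 * integral {- p $ 2 / 4..p $ 2 / 4} (\<lambda>z. sym_distortion h (p $ 1 + z) (p $ 2 - \<bar>z\<bar>)))"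
    using tent_average_eq[OF _ continuous_on_sym_distortion[OF h], of p] p
    by (simp add: upper_half_plane_def)
  ultimately show ?thesis by simp
qed

section \<open>Comparison of the integrals\<close>

theorem theorem1p7:
  fixes C0 :: real
  assumes "C0 > 0"
    and "\<And>h x y. increasing_homeo h \<Longrightarrow> y > 0 \<Longrightarrow>
           sym_distortion h x y / 4 \<le> BA_dilatation h x y \<and>
           BA_dilatation h x y \<le>
             C0 * max (sym_distortion h x y)
                      (2 / y * integral {- y / 4..y / 4} (\<lambda>z. sym_distortion h (x + z) (y - \<bar>z\<bar>)))"
  shows "\<exists>C::real. C > 0 \<and>
    (\<forall>(\<Phi>::real \<Rightarrow> real) h. \<Phi> ` {0..} \<subseteq> {0..} \<longrightarrow> mono_on {0..} \<Phi> \<longrightarrow> convex_on {0..} \<Phi> \<longrightarrow>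
      increasing_homeo h \<longrightarrow>
      (\<forall>q>0.
        (\<integral>\<^sup>+p\<in>upper_half_plane.
            ennreal (\<Phi> (q * inverse 4 * inverse C0 * sym_distortion h (p $ 1) (p $ 2))) \<partial>spherical_measure)
        \<le> (\<integral>\<^sup>+p\<in>upper_half_plane.
            ennreal (\<Phi> (q * inverse C0 * BA_dilatation h (p $ 1) (p $ 2))) \<partial>spherical_measure)
        \<and>
        (\<integral>\<^sup>+p\<in>upper_half_plane.
            ennreal (\<Phi> (q * inverse C0 * BA_dilatation h (p $ 1) (p $ 2))) \<partial>spherical_measure)
        \<le> ennreal C * (\<integral>\<^sup>+p\<in>upper_half_plane.
            ennreal (\<Phi> (q * sym_distortion h (p $ 1) (p $ 2))) \<partial>spherical_measure)))"
proof (intro exI[of _ 7] conjI allI impI)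
  fix \<Phi> :: "real \<Rightarrow> real" and h :: "real \<Rightarrow> real" and q :: real
  assume \<Phi>: "\<Phi> ` {0..} \<subseteq> {0..}" "mono_on {0..} \<Phi>" "convex_on {0..} \<Phi>"
    and h: "increasing_homeo h" and "q > 0"
  let ?R = "\<lambda>p. sym_distortion h (p $ 1) (p $ 2)"
  let ?K = "\<lambda>p. BA_dilatation h (p $ 1) (p $ 2)"
  let ?A = "\<lambda>p::real^2. 2 / p $ 2 *
      integral {- p $ 2 / 4..p $ 2 / 4} (\<lambda>z. sym_distortion h (p $ 1 + z) (p $ 2 - \<bar>z\<bar>))"
  have mono: "\<Phi> a \<le> \<Phi> b" if "0 \<le> a" "a \<le> b" for a b
    using \<Phi>(2) that by (auto simp: mono_on_def)
  have R: "?R p \<ge> 1" if "p \<in> upper_half_plane" for p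
    using that sym_distortion_ge_1[OF h] by (simp add: upper_half_plane_def)
  have K: "?R p / 4 \<le> ?K p" "?K p \<le> C0 * max (?R p) (?A p)" if "p \<in> upper_half_plane" for p
    using that assms(2)[OF h, of "p $ 2" "p $ 1"] by (auto simp: upper_half_plane_def)
  show "(\<integral>\<^sup>+p\<in>upper_half_plane. ennreal (\<Phi> (q * inverse 4 * inverse C0 * ?R p)) \<partial>spherical_measure)
      \<le> (\<integral>\<^sup>+p\<in>upper_half_plane. ennreal (\<Phi> (q * inverse C0 * ?K p)) \<partial>spherical_measure)"
  proof (rule nn_integral_mono)
    fix p :: "real^2"
    show "ennreal (\<Phi> (q * inverse 4 * inverse C0 * ?R p)) * indicator upper_half_plane p
        \<le> ennreal (\<Phi> (q * inverse C0 * ?K p)) * indicator upper_half_plane p"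
    proof (cases "p \<in> upper_half_plane")
      case True
      have eq: "q * inverse 4 * inverse C0 * ?R p = q * inverse C0 * (?R p / 4)" by simp
      have nonneg: "0 \<le> q * inverse C0 * (?R p / 4)" using R[OF True] \<open>q > 0\<close> \<open>C0 > 0\<close> by simp
      have "q * inverse C0 * (?R p / 4) \<le> q * inverse C0 * ?K p"
        using K(1)[OF True] \<open>q > 0\<close> \<open>C0 > 0\<close> by (intro mult_left_mono) auto
      then show ?thesis
        using True nonneg by (simp add: ennreal_leI mono eq)
    qed simp
  qed
  define G where "G = (\<lambda>p. ennreal (\<Phi> (q * ?R p)) * indicator upper_half_plane p)"
  have conv: "convex_on {0<..} \<Phi>" using \<Phi>(3) by (rule convex_on_subset) auto
  then have "continuous_on {0<..} \<Phi>" by (intro convex_on_continuous) auto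
  then have "continuous_on upper_half_plane (\<lambda>p. \<Phi> (q * ?R p))"
  proof (rule continuous_on_compose2)
    show "continuous_on upper_half_plane (\<lambda>p. q * ?R p)"
      by (intro continuous_on_mult_left continuous_on_sym_distortion h)
    show "(\<lambda>p. q * ?R p) ` upper_half_plane \<subseteq> {0<..}"
      using \<open>q > 0\<close> less_le_trans[OF zero_less_one R] by auto
  qed
  then have "(\<lambda>p. indicator upper_half_plane p *\<^sub>R \<Phi> (q * ?R p)) \<in> borel_measurable borel"
    by (intro borel_measurable_continuous_on_indicator) auto
  moreover have "G = (\<lambda>p. ennreal (indicator upper_half_plane p *\<^sub>R \<Phi> (q * ?R p)))"
    by (auto simp: G_def fun_eq_iff split: split_indicator)
  ultimately have G: "G \<in> borel_measurable borel" by simp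
  \<comment> \<open>\<open>J\<close> dominates the term that comes from the average of the distortion.\<close>
  define J where "J = (\<lambda>p. 2 * (\<integral>\<^sup>+s\<in>{-1/4..1/4}. G (shear_matrix s *v p) \<partial>lborel))"
  have "(\<lambda>(s, p). G (shear_matrix s *v p)) \<in> borel_measurable (borel \<Otimes>\<^sub>M borel)"
    using measurable_compose[OF measurable_shear G] by (simp add: case_prod_unfold)
  then have "(\<lambda>(p, s). G (shear_matrix s *v p)) \<in> borel_measurable (borel \<Otimes>\<^sub>M borel)"
    by (subst measurable_pair_swap_iff) (simp add: case_prod_unfold)
  then have [measurable]: "J \<in> borel_measurable borel"
    unfolding J_def by measurable
  have "(\<integral>\<^sup>+p\<in>upper_half_plane. ennreal (\<Phi> (q * inverse C0 * ?K p)) \<partial>spherical_measure)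
      \<le> (\<integral>\<^sup>+p. G p + J p \<partial>spherical_measure)"
  proof (rule nn_integral_mono)
    fix p :: "real^2"
    show "ennreal (\<Phi> (q * inverse C0 * ?K p)) * indicator upper_half_plane p \<le> G p + J p"
    proof (cases "p \<in> upper_half_plane")
      case True
      have "q * inverse C0 * ?K p \<le> q * inverse C0 * (C0 * max (?R p) (?A p))"
        using K(2)[OF True] \<open>q > 0\<close> \<open>C0 > 0\<close> by (intro mult_left_mono) auto
      also have "\<dots> = q * max (?R p) (?A p)" using \<open>C0 > 0\<close> by simp
      finally have "\<Phi> (q * inverse C0 * ?K p) \<le> \<Phi> (q * max (?R p) (?A p))"
        using K(1)[OF True] R[OF True] \<open>q > 0\<close> \<open>C0 > 0\<close> by (intro mono) auto
      then have "ennreal (\<Phi> (q * inverse C0 * ?K p)) \<le> ennreal (\<Phi> (q * max (?R p) (?A p)))"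
        by (rule ennreal_leI)
      also have "\<dots> \<le> ennreal (\<Phi> (q * ?R p)) + ennreal (\<Phi> (q * ?A p))"
        by (simp add: max_def)
      also have "ennreal (\<Phi> (q * ?R p)) = G p" using True by (simp add: G_def)
      also have "ennreal (\<Phi> (q * ?A p)) \<le> J p"
      proof -
        have "ennreal (\<Phi> (q * ?A p)) \<le> 2 * (\<integral>\<^sup>+s\<in>{-1/4..1/4}. ennreal (\<Phi> (q * ?R (shear_matrix s *v p))) \<partial>lborel)"
          using \<Phi>(1) by (intro jensen_tent_average h True \<open>q > 0\<close> conv) (auto simp: image_subset_iff)
        also have "\<dots> = J p"
          unfolding J_def G_def using shear_in_upper_half_plane[OF True]
          by (intro arg_cong[where f="(*) 2"] nn_integral_cong) (auto split: split_indicator)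
        finally show ?thesis .
      qed
      finally show ?thesis using True by (simp add: add_left_mono)
    qed simp
  qed
  also have "\<dots> = (\<integral>\<^sup>+p. spherical_density p * G p \<partial>lborel) + (\<integral>\<^sup>+p. spherical_density p * J p \<partial>lborel)"
    using G by (subst nn_integral_spherical_measure) (auto simp: distrib_left intro!: nn_integral_add)
  also have "\<dots> \<le> (\<integral>\<^sup>+p. spherical_density p * G p \<partial>lborel)
      + 6 * (\<integral>\<^sup>+p. spherical_density p * G p \<partial>lborel)"
    unfolding J_def by (intro add_left_mono nn_integral_spherical_shear_average G)
  also have "\<dots> = (1 + 6) * (\<integral>\<^sup>+p. spherical_density p * G p \<partial>lborel)"
    by (simp only: distrib_right mult_1)
  also have "\<dots> = ennreal 7 * (\<integral>\<^sup>+p\<in>upper_half_plane. ennreal (\<Phi> (q * ?R p)) \<partial>spherical_measure)"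
    using nn_integral_spherical_measure[OF G] by (simp add: G_def)
  finally show "(\<integral>\<^sup>+p\<in>upper_half_plane. ennreal (\<Phi> (q * inverse C0 * ?K p)) \<partial>spherical_measure)
      \<le> ennreal 7 * (\<integral>\<^sup>+p\<in>upper_half_plane. ennreal (\<Phi> (q * ?R p)) \<partial>spherical_measure)" .
qed simp

end
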